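(* Let $P=\{p_k;k\ge1\}$ be a probability distribution on a countably infinite alphabet $\mathscr{X}$, and let $k_0\ge 1$ be an integer and $\lambda>0$, $r\in(-\infty,+\infty)$, $a>0$, $b>0$, $c>0$ be constants. If one of the following holds: (i) $p_k=ae^{-\lambda k}$ for all $k\ge k_0$; (ii) $p_k=be^{-\lambda k^2}$ for all $k\ge k_0$; (iii) $p_k=ck^re^{-\lambda k}$ for all $k\ge k_0$; then $P$ is in Domain 1.
   Context: A probability distribution on $\mathscr{X}=\{\ell_k;k\ge 1\}$ is a sequence $P=\{p_k;k\ge 1\}$ with $p_k\ge 0$ and $\sum_{k\ge1}p_k=1$. Its tail index is $t_n=\sum_{k\ge 1}np_k(1-p_k)^n$, $n\ge 1$. $P$ belongs to Domain 1 if $\limsup_{n\to\infty}t_n=c_P$ for some (finite) constant $c_P>0$. *)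

theory Defs
  imports "HOL-Analysis.Analysis"
begin

(* A distribution on {l_k; k >= 1} is the sequence of its probabilities, as a function on nat
   of which only the values at k >= 1 matter. *)
definition prob_distribution :: "(nat \<Rightarrow> real) \<Rightarrow> bool" where
  "prob_distribution p \<longleftrightarrow> (\<forall>k\<ge>1. 0 \<le> p k) \<and> (p has_sum 1) {1..}"

definition tail_index :: "(nat \<Rightarrow> real) \<Rightarrow> nat \<Rightarrow> real" where
  "tail_index p n = (\<Sum>\<^sub>\<infinity>k\<in>{1..}. real n * p k * (1 - p k) ^ n)"

(* The limsup is taken in the extended reals, where it always exists; membership says that it
   is a finite positive number. *)
definition domain1 :: "(nat \<Rightarrow> real) \<Rightarrow> bool" where
  "domain1 p \<longleftrightarrow> (\<exists>c::real. c > 0 \<and> limsup (\<lambda>n. ereal (tail_index p n)) = ereal c)"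

(* The series defining the tail index converges, so infsum does not take its default value. *)
lemma tail_index_summable:
  assumes "prob_distribution p"
  shows "(\<lambda>k. real n * p k * (1 - p k) ^ n) summable_on {1..}"
proof -
  have nonneg: "0 \<le> p k" if "k \<in> {1..}" for k
    using assms that by (auto simp: prob_distribution_def)
  have hs: "(p has_sum 1) {1..}"
    using assms by (simp add: prob_distribution_def)
  have le1: "p k \<le> 1" if "k \<in> {1..}" for k
  proof -
    have "(p has_sum p k) {k}"
      using has_sum_finite[of "{k}" p] by simp
    from has_sum_mono2[OF this hs] show ?thesis
      using that nonneg by auto
  qed
  have "(\<lambda>k. real n * p k) summable_on {1..}"
    using hs by (intro summable_on_cmult_right) (auto simp: summable_on_def)
  then show ?thesis
  proof (rule summable_on_comparison_test)
    fix k :: nat assume k: "k \<in> {1..}"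
    show "real n * p k * (1 - p k) ^ n \<le> real n * p k"
      using nonneg[OF k] le1[OF k] by (intro mult_left_le power_le_one) auto
    show "0 \<le> real n * p k * (1 - p k) ^ n"
      using nonneg[OF k] le1[OF k] by simp
  qed
qed

end

theory Submission
  imports Defs "HOL-Real_Asymp.Real_Asymp"
begin

text \<open>
  In all three cases \<open>p (k + 1) \<le> q * p k\<close> eventually, for some \<open>q < 1\<close>. By convexity of the
  exponential, \<open>n * p k * (1 - p k) ^ n\<close> is then at most \<open>1 / (1 - q)\<close> times
  \<open>exp (- n * p (k + 1)) - exp (- n * p k)\<close>, so these summands telescope to a bounded total; each
  of the finitely many others is at most 1.
  Conversely, for \<open>n\<close> close to \<open>1 / (2 * p k)\<close> the \<open>k\<close>-th summand alone is at least \<open>1 / 8\<close>.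
\<close>

lemma prob_distribution_nonneg:
  "prob_distribution p \<Longrightarrow> k \<ge> 1 \<Longrightarrow> 0 \<le> p k"
  by (simp add: prob_distribution_def)

lemma prob_distribution_le_1:
  assumes "prob_distribution p" "k \<ge> 1"
  shows "p k \<le> 1"
proof -
  have hs: "(p has_sum 1) {1..}"
    using assms by (simp add: prob_distribution_def)
  have "(p has_sum p k) {k}"
    using has_sum_finite[of "{k}" p] by simp
  from has_sum_mono2[OF this hs] show ?thesis
    using assms prob_distribution_nonneg[OF assms(1)] by auto
qed

lemma prob_distribution_tendsto_0:
  assumes "prob_distribution p"
  shows "p \<longlonglongrightarrow> 0"
proof -
  have "p summable_on {1..}"
    using assms by (auto simp: prob_distribution_def summable_on_def)
  \<comment> \<open>\<open>p 0\<close> is unconstrained, so the index is shifted before passing to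
    an ordinary series.\<close>
  then have "(\<lambda>k. p (Suc k)) summable_on UNIV"
    using summable_on_reindex_bij_betw[of Suc UNIV "{1::nat..}" p]
    by (auto simp: bij_betw_def image_iff dest: Suc_le_D)
  then have "summable (\<lambda>k. p (Suc k))"
    by (rule summable_on_imp_summable)
  then have "(\<lambda>k. p (Suc k)) \<longlonglongrightarrow> 0"
    by (rule summable_LIMSEQ_zero)
  then show ?thesis
    by (rule LIMSEQ_imp_Suc)
qed

lemma mult_power_one_minus_le_exp:
  fixes x :: real
  assumes "0 \<le> x" "x \<le> 1"
  shows "real n * x * (1 - x) ^ n \<le> real n * x * exp (- (real n * x))"
proof -
  have "(1 - x) ^ n \<le> exp (- x) ^ n"
    using assms exp_ge_add_one_self[of "- x"] by (intro power_mono) auto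
  also have "\<dots> = exp (- (real n * x))"
    by (simp flip: exp_of_nat_mult)
  finally show ?thesis
    using assms by (intro mult_left_mono) auto
qed

text \<open>After the exponential bound, this is \<open>t * exp (- t) \<le> 1\<close> for
  \<open>t = n * x\<close>, which follows from \<open>t \<le> 1 + t \<le> exp t\<close>.\<close>

lemma mult_power_one_minus_le_1:
  fixes x :: real
  assumes "0 \<le> x" "x \<le> 1"
  shows "real n * x * (1 - x) ^ n \<le> 1"
proof -
  have "real n * x * exp (- (real n * x)) \<le> 1"
    using order_trans[OF _ exp_ge_add_one_self[of "real n * x"], of "real n * x"]
    by (simp add: exp_minus divide_simps)
  with mult_power_one_minus_le_exp[OF assms, of n] show ?thesis
    by linarith
qed

text \<open>The hypotheses give \<open>(1 - q) * x \<le> x - y\<close>, and the graph of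
  \<open>exp (- t)\<close> lies above its tangent at \<open>x\<close>. This is the inequality that
  makes the tail telescope.\<close>

lemma mult_exp_minus_le_exp_diff:
  fixes x y q :: real
  assumes "y \<le> q * x" "q < 1"
  shows "x * exp (- x) \<le> (exp (- y) - exp (- x)) / (1 - q)"
proof -
  have "x * (1 - q) * exp (- x) \<le> (x - y) * exp (- x)"
    using assms by (intro mult_right_mono) (auto simp: algebra_simps)
  also have "\<dots> \<le> (exp (x - y) - 1) * exp (- x)"
    by (intro mult_right_mono) (use exp_ge_add_one_self[of "x - y"] in linarith, simp)
  also have "\<dots> = exp (- y) - exp (- x)"
    by (simp add: left_diff_distrib flip: exp_add)
  finally show ?thesis
    using assms by (simp add: divide_simps mult_ac)
qed

text \<open>The point is uniformity: \<open>K\<close> and \<open>q\<close> do not depend on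
  \<open>n\<close>, so the limsup is finite.\<close>

lemma tail_index_bounded:
  assumes p: "prob_distribution p" and K: "K \<ge> 1" and q: "q < 1"
    and ratio: "\<And>k. k \<ge> K \<Longrightarrow> p (Suc k) \<le> q * p k"
  shows "tail_index p n \<le> real K + 1 / (1 - q)"
proof -
  define f where "f = (\<lambda>k. real n * p k * (1 - p k) ^ n)"
  note nonneg = prob_distribution_nonneg[OF p] and le1 = prob_distribution_le_1[OF p]
  \<comment> \<open>Keeping the difference of exponentials, rather than bounding it by 1 at once, is
    what lets the induction close.\<close>
  have telescope: "sum f {1..<K + M} \<le>
      real K + (exp (- (real n * p (K + M))) - exp (- (real n * p K))) / (1 - q)" for M
  proof (induction M)
    case 0
    have "sum f {1..<K} \<le> (\<Sum>k\<in>{1..<K}. 1)"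
      unfolding f_def by (intro sum_mono mult_power_one_minus_le_1 nonneg le1) auto
    then show ?case by simp
  next
    case (Suc M)
    have "f (K + M) \<le> real n * p (K + M) * exp (- (real n * p (K + M)))"
      unfolding f_def using K by (intro mult_power_one_minus_le_exp nonneg le1) auto
    also have "\<dots> \<le> (exp (- (real n * p (Suc (K + M)))) - exp (- (real n * p (K + M)))) / (1 - q)"
      using mult_left_mono[OF ratio[of "K + M"], of "real n"] q
      by (intro mult_exp_minus_le_exp_diff) (auto simp: mult_ac)
    finally show ?case
      using Suc K by (simp add: diff_divide_distrib)
  qed
  have "sum f {1..<K + M} \<le> real K + 1 / (1 - q)" for M
  proof -
    have "exp (- (real n * p (K + M))) \<le> 1"
      using nonneg[of "K + M"] K by simp
    then have "exp (- (real n * p (K + M))) - exp (- (real n * p K)) \<le> 1"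
      using exp_ge_zero[of "- (real n * p K)"] by linarith
    then show ?thesis
      using telescope[of M] q
        divide_right_mono[of "exp (- (real n * p (K + M))) - exp (- (real n * p K))" 1 "1 - q"]
      by linarith
  qed
  \<comment> \<open>The summands are nonnegative, so enlarging \<open>F\<close> to an initial
    segment only increases the sum.\<close>
  moreover have "sum f F \<le> sum f {1..<K + Suc (Max F)}" if "finite F" "F \<subseteq> {1..}" for F
    using that nonneg le1 Max_ge[of F]
    by (intro sum_mono2) (fastforce simp: f_def less_Suc_eq_le intro: trans_le_add2)+
  ultimately have "sum f F \<le> real K + 1 / (1 - q)" if "finite F" "F \<subseteq> {1..}" for F
    using that order_trans by blast
  moreover have "f summable_on {1..}"
    unfolding f_def by (rule tail_index_summable[OF p])
  ultimately have "infsum f {1..} \<le> real K + 1 / (1 - q)"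
    by (intro infsum_le_finite_sums)
  then show ?thesis
    by (simp add: tail_index_def f_def)
qed

lemma tail_index_ge_term:
  assumes p: "prob_distribution p" and k: "k \<ge> 1"
  shows "real n * p k * (1 - p k) ^ n \<le> tail_index p n"
proof -
  have "sum (\<lambda>k. real n * p k * (1 - p k) ^ n) {k} \<le> tail_index p n"
    unfolding tail_index_def
    using k prob_distribution_nonneg[OF p] prob_distribution_le_1[OF p]
    by (intro finite_sum_le_infsum tail_index_summable p) auto
  then show ?thesis by simp
qed

lemma frequently_tail_index_ge:
  assumes p: "prob_distribution p" and pos: "\<forall>\<^sub>F k in sequentially. 0 < p k"
  shows "\<exists>n\<ge>N. 1 / 8 \<le> tail_index p n"
proof -
  \<comment> \<open>\<open>p k < e\<close> gives \<open>1 / (2 * p k) > N + 2\<close>, so its floor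
    is at least \<open>N\<close>; it also gives \<open>p k < 1 / 4\<close>, since
    \<open>N + 2 \<ge> 2\<close>.\<close>
  define e :: real where "e = 1 / (2 * real (N + 2))"
  have e: "0 < e" by (simp add: e_def)
  have "\<forall>\<^sub>F k in sequentially. p k < e"
    using prob_distribution_tendsto_0[OF p] e by (rule order_tendstoD)
  then obtain k where k: "0 < p k" "p k < e" "k \<ge> 1"
    using eventually_happens'[OF _ eventually_conj[OF pos
      eventually_conj[OF _ eventually_ge_at_top[of 1]]]] sequentially_bot by blast
  define n where "n = nat \<lfloor>1 / (2 * p k)\<rfloor>"
  have "real (N + 2) < 1 / (2 * p k)"
    using k by (simp add: e_def field_simps)
  then have "N \<le> n"
    unfolding n_def by linarith
  have n: "real n \<le> 1 / (2 * p k)" "1 / (2 * p k) - 1 \<le> real n"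
    using k(1) of_int_floor_le[of "1 / (2 * p k)"] real_of_int_floor_add_one_gt[of "1 / (2 * p k)"]
    unfolding n_def by auto
  have le: "real n * p k \<le> 1 / 2"
    using mult_right_mono[OF n(1), of "p k"] k by simp
  have "e \<le> 1 / 4"
    by (simp add: e_def field_simps)
  \<comment> \<open>Rounding down costs at most \<open>p k < 1 / 4\<close> of the ideal value
    \<open>1 / 2\<close>.\<close>
  then have ge: "1 / 4 \<le> real n * p k"
    using mult_right_mono[OF n(2), of "p k"] k by (simp add: left_diff_distrib)
  have "1 + real n * (- p k) \<le> (1 + (- p k)) ^ n"
    using k \<open>e \<le> 1 / 4\<close> by (intro Bernoulli_inequality) simp
  then have "1 / 2 \<le> (1 - p k) ^ n"
    using le by simp
  with ge have "1 / 4 * (1 / 2) \<le> real n * p k * (1 - p k) ^ n"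
    by (intro mult_mono) auto
  with tail_index_ge_term[OF p k(3), of n] \<open>N \<le> n\<close> show ?thesis
    by (intro exI[of _ n]) simp
qed

lemma domain1I_ratio:
  assumes p: "prob_distribution p" and q: "q < 1"
    and pos: "\<forall>\<^sub>F k in sequentially. 0 < p k"
    and ratio: "\<forall>\<^sub>F k in sequentially. p (Suc k) \<le> q * p k"
  shows "domain1 p"
proof -
  define L where "L = limsup (\<lambda>n. ereal (tail_index p n))"
  obtain K where K: "K \<ge> 1" "\<And>k. k \<ge> K \<Longrightarrow> p (Suc k) \<le> q * p k"
    using eventually_conj[OF eventually_ge_at_top[of 1] ratio]
    unfolding eventually_sequentially by blast
  have "L \<le> ereal (real K + 1 / (1 - q))"
    unfolding L_def by (intro Limsup_bounded always_eventually allI)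
      (simp only: ereal_less_eq(3), rule tail_index_bounded[OF p K(1) q], rule K(2))
  \<comment> \<open>Each supremum over \<open>n \<ge> N\<close> is at least \<open>1 / 8\<close>,
    hence so is their infimum over \<open>N\<close>.\<close>
  moreover have "ereal (1 / 8) \<le> L"
    unfolding L_def limsup_INF_SUP
    by (intro INF_greatest)
       (metis frequently_tail_index_ge[OF p pos] SUP_upper2 atLeast_iff ereal_less_eq(3))
  ultimately show ?thesis
    unfolding domain1_def L_def[symmetric] by (cases L) auto
qed

theorem corollary2:
  fixes p :: "nat \<Rightarrow> real" and k0 :: nat and lam r a b c :: real
  assumes "prob_distribution p"
    and "k0 \<ge> 1" and "lam > 0" and "a > 0" and "b > 0" and "c > 0"
    and "(\<forall>k\<ge>k0. p k = a * exp (- lam * real k)) \<or>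
         (\<forall>k\<ge>k0. p k = b * exp (- lam * (real k)^2)) \<or>
         (\<forall>k\<ge>k0. p k = c * real k powr r * exp (- lam * real k))"
  shows "domain1 p"
proof -
  \<comment> \<open>One ratio \<open>exp (- lam / 2)\<close> serves all three families. Giving up
    half of the decay rate leaves room for the factor \<open>k powr r\<close> in the third, where
    the ratio only tends to \<open>exp (- lam)\<close>.\<close>
  have *: "domain1 p"
    if "\<And>k. k \<ge> k0 \<Longrightarrow> p k = g k" "\<And>k. k \<ge> 1 \<Longrightarrow> 0 < g k"
      "\<forall>\<^sub>F k in sequentially. g (Suc k) \<le> exp (- lam / 2) * g k" for g
  proof (rule domain1I_ratio[OF assms(1), of "exp (- lam / 2)"])
    show "\<forall>\<^sub>F k in sequentially. 0 < p k"
      using eventually_ge_at_top[of k0] by eventually_elim (use that assms(2) in auto)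
    show "\<forall>\<^sub>F k in sequentially. p (Suc k) \<le> exp (- lam / 2) * p k"
      using eventually_ge_at_top[of k0] that(3) by eventually_elim (simp add: that(1))
  qed (use assms(3) in auto)
  from assms(7) show ?thesis
  proof (elim disjE)
    assume "\<forall>k\<ge>k0. p k = a * exp (- lam * real k)"
    then show ?thesis
      using assms(3,4)
      by (intro *[of "\<lambda>k. a * exp (- lam * real k)"]) (auto simp: algebra_simps simp flip: exp_add)
  next
    assume p: "\<forall>k\<ge>k0. p k = b * exp (- lam * (real k)^2)"
    \<comment> \<open>The exponent drops by \<open>lam * (2 * k + 1)\<close>, which is at least
      \<open>lam / 2\<close>.\<close>
    have "- lam * (real (Suc k))^2 \<le> - lam / 2 + - lam * (real k)^2" for k
    proof -
      have "- (lam / 2) \<le> lam * (real k * 2)"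
        by (rule order_trans[of _ 0]) (use assms(3) in simp_all)
      then show ?thesis
        by (simp add: power2_eq_square algebra_simps)
    qed
    then have "exp (- lam * (real (Suc k))^2) \<le> exp (- lam / 2) * exp (- lam * (real k)^2)" for k
      by (simp only: exp_le_cancel_iff flip: exp_add)
    then have "b * exp (- lam * (real (Suc k))^2) \<le>
        exp (- lam / 2) * (b * exp (- lam * (real k)^2))" for k
      unfolding mult.left_commute[of _ b] using assms(5) by (intro mult_left_mono) auto
    then show ?thesis
      using p assms(5)
      by (intro *[of "\<lambda>k. b * exp (- lam * (real k)^2)"] always_eventually allI) simp_all
  next
    assume p: "\<forall>k\<ge>k0. p k = c * real k powr r * exp (- lam * real k)"
    \<comment> \<open>Whatever the sign of \<open>r\<close>, the power factor grows by a ratio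
      tending to 1, hence eventually below \<open>exp (lam / 2)\<close>.\<close>
    have "((\<lambda>k. (real (Suc k) / real k) powr r) \<longlongrightarrow> 1) sequentially"
      by real_asymp
    then have "\<forall>\<^sub>F k in sequentially. (real (Suc k) / real k) powr r < exp (lam / 2)"
      by (rule order_tendstoD) (use assms(3) in simp)
    then have "\<forall>\<^sub>F k in sequentially. c * real (Suc k) powr r * exp (- lam * real (Suc k)) \<le>
        exp (- lam / 2) * (c * real k powr r * exp (- lam * real k))"
      using eventually_gt_at_top[of 0]
    proof eventually_elim
      case (elim k)
      then have "real (Suc k) powr r \<le> exp (lam / 2) * real k powr r"
        by (simp add: powr_divide divide_simps)
      then have "c * real (Suc k) powr r * exp (- lam * real (Suc k)) \<le>
          c * (exp (lam / 2) * real k powr r) * exp (- lam * real (Suc k))"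
        using assms(6) by (intro mult_right_mono mult_left_mono) auto
      also have "\<dots> = c * real k powr r * exp (lam / 2 + - lam * real (Suc k))"
        by (simp only: exp_add) (simp add: mult_ac)
      \<comment> \<open>Of the decay \<open>lam\<close> gained in one step, half pays for the power
        factor and half remains.\<close>
      also have "lam / 2 + - lam * real (Suc k) = - lam / 2 + - lam * real k"
        by (simp add: algebra_simps)
      finally show ?case
        by (simp only: exp_add) (simp add: mult_ac)
    qed
    then show ?thesis
      by (intro *[of "\<lambda>k. c * real k powr r * exp (- lam * real k)"]) (use p assms(6) in auto)
  qed
qed

end
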